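(* Let $m\ge 2$ and let $N\ge 1$ be an integer. Then there exists a constant $\gamma_{m,N}>0$ such that $$\lambda_{n+N}(q_m)-\lambda_n(q_m)\ \ge\ N\,\gamma_{m,N}\qquad\text{for all } n\ge 1.$$ Moreover, let $(x_h)_{h\ge 0}\in\{0,1\}^{\infty}$ be the canonical $m$-bonacci expansion of $N$, and let $b_m$ be a positive integer such that the $m$-bonacci word $\mathbf v_m$ is $b_m$-balanced. Then the displayed inequality (for all $n\ge 1$) is also satisfied by the explicit choice $$\gamma_{m,N}=\frac1N\sum_{j=1}^m\left(\sum_{h\ge 0}x_hF^{(m)}_{h-j}-b_m\right)d_m(j),$$ where $d_m(j):=q_m^{j-1}-\sum_{k=0}^{j-2}q_m^k$ for $j=1,\dots,m$ (so $d_m(1)=1$).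
   Context: For $m\ge 2$, $q_m\in(1,2)$ denotes the largest real root of $x^m-x^{m-1}-\cdots-x-1$. The spectrum of $q_m$ is $\Lambda(q_m):=\left\{\sum_{i=0}^n\varepsilon_i q_m^i \mid \varepsilon_i\in\{0,1\},\ n=0,1,\dots\right\}$. Its elements are listed in strictly increasing order as $\Lambda(q_m)=\{0<\lambda_1(q_m)<\lambda_2(q_m)<\cdots\}$. The $m$-bonacci sequence is defined by $F^{(m)}_i=2^i$ for $0\le i\le m-1$ and $F^{(m)}_n=F^{(m)}_{n-1}+\cdots+F^{(m)}_{n-m}$ for $n\ge m$. It is extended to negative indices by $F^{(m)}_{-1}=1$ and $F^{(m)}_{-k}=0$ for all $k>1$. The canonical $m$-bonacci expansion of $N$ is the binary sequence $(x_h)_{h\ge0}$ with only finitely many nonzero terms, containing no block of $m$ consecutive $1$'s, such that $N=\sum_{h\ge 0}x_hF^{(m)}_h$. It is produced by the greedy algorithm, which repeatedly subtracts the largest $F^{(m)}_h$ not exceeding the current remainder. The Rauzy substitution $\sigma_m$ on finite words over $\{1,\dots,m\}$ is given by $k\mapsto 1(k+1)$ for $k=1,\dots,m-1$ and $m\mapsto 1$, extended to words by concatenation. The $m$-bonacci word is the infinite word $\mathbf v_m:=\lim_{n\to\infty}\sigma_m^n(1)$. For a positive integer $b$, an infinite word $\mathbf v$ over $\{1,\dots,m\}$ is $b$-balanced if for any two finite subwords (blocks of consecutive letters) $u,w$ of $\mathbf v$ of the same length and every letter $j$, one has $\bigl||u|_j-|w|_j\bigr|\le b$, where $|w|_j$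 is the number of occurrences of $j$ in $w$. *)

theory Defs
  imports Complex_Main
begin

definition mbonacci_root :: "nat \<Rightarrow> real" where
  "mbonacci_root m = Max {x. x ^ m - (\<Sum>i<m. x ^ i) = 0}"

definition spectrum :: "real \<Rightarrow> real set" where
  "spectrum q = {(\<Sum>i\<le>n. \<epsilon> i * q ^ i) | \<epsilon> n. \<forall>i. \<epsilon> i \<in> {0, 1}}"

text \<open>The increasing listing starts at index 0 with the element 0 of the spectrum.\<close>

definition spectrum_enum :: "real \<Rightarrow> nat \<Rightarrow> real" where
  "spectrum_enum q = (THE f. strict_mono f \<and> range f = spectrum q)"

function mbonacci_nat :: "nat \<Rightarrow> nat \<Rightarrow> nat" where
  "mbonacci_nat m n = (if n < m then 2 ^ n else (\<Sum>i = 1..m. mbonacci_nat m (n - i)))"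
  by auto
termination
  by (relation "measure snd") auto

declare mbonacci_nat.simps [simp del]

definition mbonacci :: "nat \<Rightarrow> int \<Rightarrow> int" where
  "mbonacci m k =
     (if k \<ge> 0 then int (mbonacci_nat m (nat k)) else if k = - 1 then 1 else 0)"

definition canonical_expansion :: "nat \<Rightarrow> nat \<Rightarrow> (nat \<Rightarrow> nat) \<Rightarrow> bool" where
  "canonical_expansion m N x \<longleftrightarrow>
     (\<forall>h. x h \<in> {0, 1}) \<and>
     finite {h. x h \<noteq> 0} \<and>
     (\<nexists>h. \<forall>i<m. x (h + i) = 1) \<and>
     int N = (\<Sum>h | x h \<noteq> 0. int (x h) * mbonacci m (int h))"

text \<open>Letters are natural numbers; on letters outside \<open>{1..m}\<close> the value is irrelevant.\<close>

definition rauzy_letter :: "nat \<Rightarrow> nat \<Rightarrow> nat list" where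
  "rauzy_letter m k = (if k < m then [1, k + 1] else [1])"

definition rauzy_subst :: "nat \<Rightarrow> nat list \<Rightarrow> nat list" where
  "rauzy_subst m w = concat (map (rauzy_letter m) w)"

text \<open>
  The limit of the words is taken letter by letter, in the discrete space \<open>nat\<close>.  For a fixed
  position \<open>i\<close> only finitely many of the words are too short for \<open>! i\<close> to be meaningful
  (if \<open>m \<ge> 2\<close>), so these do not affect the limit.
\<close>

definition mbonacci_word :: "nat \<Rightarrow> nat \<Rightarrow> nat" where
  "mbonacci_word m i = lim (\<lambda>n. ((rauzy_subst m ^^ n) [1]) ! i)"

definition subword :: "'a list \<Rightarrow> (nat \<Rightarrow> 'a) \<Rightarrow> bool" where
  "subword u v \<longleftrightarrow> (\<exists>i. u = map v [i..<i + length u])"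

definition balanced :: "nat \<Rightarrow> nat \<Rightarrow> (nat \<Rightarrow> nat) \<Rightarrow> bool" where
  "balanced m b v \<longleftrightarrow>
     (\<forall>u w. subword u v \<and> subword w v \<and> length u = length w \<longrightarrow>
        (\<forall>j\<in>{1..m}. \<bar>int (count_list u j) - int (count_list w j)\<bar> \<le> int b))"

text \<open>Intended for \<open>j \<ge> 1\<close>; the sum is empty for \<open>j = 1\<close>.\<close>

definition gap_length :: "nat \<Rightarrow> nat \<Rightarrow> real" where
  "gap_length m j = mbonacci_root m ^ (j - 1) - (\<Sum>k<j - 1. mbonacci_root m ^ k)"

end

theory Submission
  imports Defs "HOL-Library.Sublist"
begin

text \<open>
  Write \<open>q\<close> for \<open>mbonacci_root m\<close> and \<open>v\<close> for the \<open>m\<close>-bonacci word.  Read every letter \<open>j\<close> of \<open>v\<close> as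
  a tile of length \<open>d(j) = gap_length m j\<close> and put the tiles side by side, beginning at 0.  The whole
  proof rests on the fact that the spectrum is the set of end points of these tiles, so that its
  successive gaps, in order, are \<open>d(v\<^sub>0), d(v\<^sub>1), \<dots>\<close>.

  This fact (\<open>range_tiling_point\<close>) holds because both sets are generated from 0 by the maps
  \<open>x \<mapsto> q x\<close> and \<open>x \<mapsto> q x + 1\<close>.  For the spectrum this is Horner's scheme.  For the tiling, the
  lengths \<open>d(j)\<close> form a left eigenvector of the incidence matrix of the substitution for the
  eigenvalue \<open>q\<close>: one has \<open>q d(j) = 1 + d(j + 1)\<close>, and \<open>d(m + 1) = 0\<close> is the equation that defines \<open>q\<close>.
  So the substitution stretches a tiled length by \<open>q\<close> (\<open>tiled_length_rauzy_subst\<close>).  As the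
  substitution fixes \<open>v\<close> and maps every letter to a word that begins with the letter 1, of length
  \<open>d(1) = 1\<close>, an end point \<open>x\<close> of a tile gives the end points \<open>q x\<close> and \<open>q x + 1\<close>; as the image of a
  letter has at most two letters, there are no others.

  Since all \<open>d(j)\<close> are positive, each gap is at least \<open>min d\<close>, and this is a first constant.  For the
  explicit one, the difference of the elements with indices \<open>n + N\<close> and \<open>n\<close> is \<open>\<Sum>\<^sub>j |w|\<^sub>j d(j)\<close>, where
  \<open>w\<close> is the subword of \<open>v\<close> of length \<open>N\<close> at position \<open>n\<close>.  By balance, \<open>|w|\<^sub>j\<close> is at least \<open>|p|\<^sub>j - b\<close>,
  where \<open>p\<close> is the initial subword of length \<open>N\<close>.  The letters of \<open>p\<close> can be counted
  (\<open>count_initial_word_expansion\<close>): the iterates \<open>\<sigma>\<^sup>h(1)\<close> of the substitution have length \<open>F\<^sub>h\<close> and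
  contain the letter \<open>j\<close> exactly \<open>F\<^sub>h\<^sub>-\<^sub>j\<close> times, and \<open>p\<close> is the concatenation of those \<open>\<sigma>\<^sup>h(1)\<close> with
  \<open>x\<^sub>h = 1\<close>, in order of decreasing \<open>h\<close>.
\<close>

section \<open>The root and the tile lengths\<close>

lemma mbonacci_root_equation_and_pos:
  assumes "m \<ge> 2"
  shows "mbonacci_root m ^ m = (\<Sum>i<m. mbonacci_root m ^ i)" and "mbonacci_root m > 0"
proof -
  let ?R = "{x::real. x ^ m - (\<Sum>i<m. x ^ i) = 0}"
  \<comment> \<open>The maximum in the definition is meaningful: the roots are finitely many, and one lies in \<open>[1, 2]\<close>.\<close>
  have "finite {x::real. (\<Sum>i\<le>m. (if i = m then 1 else - 1) * x ^ i) = 0}"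
    by (rule polyfun_finite_roots[THEN iffD2]) (auto intro: exI[of _ m])
  moreover have "(\<Sum>i\<le>m. (if i = m then 1 else - 1) * x ^ i) = x ^ m - (\<Sum>i<m. x ^ i)"
    for x :: real
    by (simp add: lessThan_Suc_atMost[symmetric] sum_negf)
  ultimately have fin: "finite ?R"
    by simp
  have at2: "(\<Sum>i<m. (2::real) ^ i) = 2 ^ m - 1"
    by (induction m) auto
  have "\<exists>x\<ge>1. x \<le> 2 \<and> x ^ m - (\<Sum>i<m. x ^ i) = (0::real)"
    using assms at2 by (intro IVT' continuous_intros) auto
  then obtain x :: real where x: "x \<ge> 1" "x \<in> ?R"
    by auto
  have "x \<le> mbonacci_root m"
    unfolding mbonacci_root_def using fin x(2) by (rule Max_ge)
  with x(1) show "mbonacci_root m > 0"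
    by simp
  have "mbonacci_root m \<in> ?R"
    unfolding mbonacci_root_def using fin x(2) by (intro Max_in) auto
  then show "mbonacci_root m ^ m = (\<Sum>i<m. mbonacci_root m ^ i)"
    by simp
qed

lemma gap_length_1 [simp]: "gap_length m (Suc 0) = 1"
  by (simp add: gap_length_def)

lemma gap_length_Suc:
  assumes "j \<ge> 1"
  shows "gap_length m (Suc j) = mbonacci_root m * gap_length m j - 1"
proof -
  obtain i where "j = Suc i"
    using assms by (cases j) auto
  then show ?thesis
    by (simp add: gap_length_def sum.lessThan_Suc_shift sum_distrib_left right_diff_distrib
        del: sum.lessThan_Suc)
qed

lemma gap_length_beyond:
  assumes "m \<ge> 2"
  shows "gap_length m (Suc m) = 0"
  using mbonacci_root_equation_and_pos(1)[OF assms] by (simp add: gap_length_def)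

text \<open>
  The recurrence \<open>q d(j) = d(j + 1) + 1\<close> carries positivity downwards from \<open>d(m + 1) = 0\<close>.
\<close>

lemma gap_length_pos:
  assumes "m \<ge> 2" and "j \<in> {1..m}"
  shows "gap_length m j > 0"
proof -
  have descend: "gap_length m i > 0" if "gap_length m (Suc i) \<ge> 0" "i \<ge> 1" for i
  proof -
    have "mbonacci_root m * gap_length m i > 0"
      using that gap_length_Suc[of i m] by simp
    then show ?thesis
      using mbonacci_root_equation_and_pos(2)[OF assms(1)] by (simp add: zero_less_mult_iff)
  qed
  have "j \<le> m"
    using assms by simp
  then show ?thesis
    using assms(2)
  proof (induction j rule: inc_induct)
    case base
    then show ?case
      using descend[of m] gap_length_beyond[OF assms(1)] assms(1) by simp
  next
    case (step j)
    then show ?case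
      using descend[of j] by simp
  qed
qed

section \<open>The substitution and its fixed point\<close>

lemma rauzy_subst_Nil [simp]: "rauzy_subst m [] = []"
  by (simp add: rauzy_subst_def)

lemma rauzy_subst_append [simp]: "rauzy_subst m (u @ w) = rauzy_subst m u @ rauzy_subst m w"
  by (simp add: rauzy_subst_def)

lemma rauzy_subst_Cons: "rauzy_subst m (k # w) = rauzy_letter m k @ rauzy_subst m w"
  by (simp add: rauzy_subst_def)

lemma rauzy_subst_letters:
  assumes "m \<ge> 2" and "set w \<subseteq> {1..m}"
  shows "set (rauzy_subst m w) \<subseteq> {1..m}"
  using assms by (auto simp: rauzy_subst_def rauzy_letter_def split: if_splits)

text \<open>
  The tile lengths are a left eigenvector of the incidence matrix.  The letter \<open>m\<close> is no exception:
  its image lacks a second letter, which corresponds to \<open>d(m + 1) = 0\<close>.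
\<close>

lemma tiled_length_rauzy_subst:
  assumes "m \<ge> 2" and "set w \<subseteq> {1..m}"
  shows "sum_list (map (gap_length m) (rauzy_subst m w)) =
    mbonacci_root m * sum_list (map (gap_length m) w)"
  using assms(2)
proof (induction w)
  case (Cons k w)
  have "sum_list (map (gap_length m) (rauzy_letter m k)) = mbonacci_root m * gap_length m k"
    using Cons.prems gap_length_Suc[of k m] gap_length_beyond[OF assms(1)]
    by (cases "k = m") (auto simp: rauzy_letter_def)
  with Cons show ?case
    by (simp add: rauzy_subst_Cons distrib_left)
qed simp

definition mbonacci_block :: "nat \<Rightarrow> nat \<Rightarrow> nat list" where
  "mbonacci_block m h = (rauzy_subst m ^^ h) [1]"

lemma mbonacci_block_0: "mbonacci_block m 0 = [1]"
  by (simp add: mbonacci_block_def)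

lemma mbonacci_block_Suc: "mbonacci_block m (Suc h) = rauzy_subst m (mbonacci_block m h)"
  by (simp add: mbonacci_block_def)

lemma mbonacci_block_letters: "m \<ge> 2 \<Longrightarrow> set (mbonacci_block m h) \<subseteq> {1..m}"
  by (induction h) (use rauzy_subst_letters in \<open>auto simp: mbonacci_block_0 mbonacci_block_Suc\<close>)

lemma mbonacci_block_strict_prefix:
  assumes "m \<ge> 2"
  shows "strict_prefix (mbonacci_block m h) (mbonacci_block m (Suc h))"
proof (induction h)
  case 0
  then show ?case
    using assms by (simp add: mbonacci_block_0 mbonacci_block_Suc rauzy_subst_def rauzy_letter_def)
next
  case (Suc h)
  then obtain k u where "mbonacci_block m (Suc h) = mbonacci_block m h @ k # u"
    by (auto elim: strict_prefixE')
  then have "mbonacci_block m (Suc (Suc h)) =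
      mbonacci_block m (Suc h) @ rauzy_letter m k @ rauzy_subst m u"
    by (simp add: mbonacci_block_Suc rauzy_subst_Cons)
  then show ?case
    by (simp add: strict_prefix_def rauzy_letter_def)
qed

lemma mbonacci_block_prefix_mono:
  assumes "m \<ge> 2" and "h \<le> k"
  shows "prefix (mbonacci_block m h) (mbonacci_block m k)"
  using assms(2)
proof (induction k rule: dec_induct)
  case (step k)
  then show ?case
    using mbonacci_block_strict_prefix[OF assms(1), of k]
    by (meson prefix_order.dual_order.strict_implies_order prefix_order.trans)
qed simp

lemma less_length_mbonacci_block:
  assumes "m \<ge> 2"
  shows "h < length (mbonacci_block m h)"
proof (induction h)
  case (Suc h)
  then show ?case
    using prefix_length_less[OF mbonacci_block_strict_prefix[OF assms, of h]] by simp
qed (simp add: mbonacci_block_0)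

text \<open>
  Each iterate extends the one before, so the sequence whose limit is the letter at position \<open>i\<close> is
  constant as soon as the iterate is longer than \<open>i\<close>.
\<close>

lemma mbonacci_word_nth:
  assumes "m \<ge> 2" and "i < length (mbonacci_block m h)"
  shows "mbonacci_word m i = mbonacci_block m h ! i"
proof -
  have "mbonacci_block m k ! i = mbonacci_block m h ! i" if "k \<ge> h" for k
    using mbonacci_block_prefix_mono[OF assms(1) that] assms(2) by (auto simp: prefix_def nth_append)
  then have "(\<lambda>k. mbonacci_block m k ! i) \<longlonglongrightarrow> mbonacci_block m h ! i"
    by (intro tendsto_eventually eventually_sequentiallyI[of h])
  then show ?thesis
    unfolding mbonacci_word_def mbonacci_block_def by (rule limI)
qed

lemma mbonacci_word_letter:
  assumes "m \<ge> 2"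
  shows "mbonacci_word m i \<in> {1..m}"
proof -
  have "i < length (mbonacci_block m i)"
    by (rule less_length_mbonacci_block) fact
  then have "mbonacci_block m i ! i \<in> {1..m}"
    using mbonacci_block_letters[OF assms, of i] nth_mem by blast
  with \<open>i < length (mbonacci_block m i)\<close> show ?thesis
    by (simp only: mbonacci_word_nth[OF assms])
qed

definition initial_word :: "nat \<Rightarrow> nat list \<Rightarrow> bool" where
  "initial_word m w \<longleftrightarrow> w = map (mbonacci_word m) [0..<length w]"

lemma initial_word_map [simp]: "initial_word m (map (mbonacci_word m) [0..<n])"
  by (simp add: initial_word_def)

lemma initial_word_letters:
  assumes "m \<ge> 2" and "initial_word m w"
  shows "set w \<subseteq> {1..m}"
proof -
  have "set w = mbonacci_word m ` {..<length w}"
    using assms(2) unfolding initial_word_def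
    by (metis atLeast0LessThan set_map set_upt)
  then show ?thesis
    by (metis image_subsetI mbonacci_word_letter[OF assms(1)])
qed

lemma initial_word_nth: "initial_word m w \<Longrightarrow> i < length w \<Longrightarrow> w ! i = mbonacci_word m i"
  unfolding initial_word_def by (metis add_0 length_map length_upt minus_nat.diff_0 nth_map_upt)

lemma initial_wordI:
  assumes "\<And>i. i < length w \<Longrightarrow> w ! i = mbonacci_word m i"
  shows "initial_word m w"
  unfolding initial_word_def by (rule nth_equalityI) (use assms in auto)

lemma prefix_mbonacci_block_imp_initial_word:
  assumes "m \<ge> 2" and "prefix w (mbonacci_block m h)"
  shows "initial_word m w"
proof (rule initial_wordI)
  fix i assume i: "i < length w"
  then have "i < length (mbonacci_block m h)"
    using prefix_length_le[OF assms(2)] by simp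
  then show "w ! i = mbonacci_word m i"
    using assms i by (auto simp: mbonacci_word_nth[of m i h] prefix_def nth_append)
qed

lemma initial_word_imp_prefix_mbonacci_block:
  assumes "m \<ge> 2" and "initial_word m w" and "length w \<le> length (mbonacci_block m h)"
  shows "prefix w (mbonacci_block m h)"
proof -
  have "w = take (length w) (mbonacci_block m h)"
    by (rule nth_equalityI)
      (use assms in \<open>simp_all add: initial_word_nth mbonacci_word_nth[of m _ h]\<close>)
  then show ?thesis
    by (metis take_is_prefix)
qed

text \<open>
  In \<open>v\<close>, the image of an initial word is followed by the image of the next letter, which begins
  with 1 whatever that letter is.  This lemma supplies the map \<open>x \<mapsto> q x + 1\<close> on end points of tiles as
  well as the digit 1 in expansions of integers.
\<close>

lemma initial_word_rauzy_subst_snoc: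
  assumes "m \<ge> 2" and "initial_word m w"
  shows "initial_word m (rauzy_subst m w @ [1])"
proof -
  let ?B = "mbonacci_block m (length w)"
  have len: "length w < length ?B"
    by (rule less_length_mbonacci_block) fact
  with assms have "prefix w ?B"
    by (intro initial_word_imp_prefix_mbonacci_block) auto
  with len obtain k u where "?B = w @ k # u"
    by (metis append_Nil2 list.exhaust nat_less_le prefix_def)
  then have "prefix (rauzy_subst m w @ [1]) (mbonacci_block m (Suc (length w)))"
    by (auto simp: mbonacci_block_Suc rauzy_subst_Cons rauzy_letter_def)
  then show ?thesis
    by (rule prefix_mbonacci_block_imp_initial_word[OF assms(1)])
qed

lemma initial_word_append_left:
  assumes "initial_word m (u @ w)"
  shows "initial_word m u"
proof (rule initial_wordI)
  fix i assume "i < length u"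
  then show "u ! i = mbonacci_word m i"
    using initial_word_nth[OF assms, of i] by (simp add: nth_append)
qed

lemma initial_word_rauzy_subst:
  "m \<ge> 2 \<Longrightarrow> initial_word m w \<Longrightarrow> initial_word m (rauzy_subst m w)"
  using initial_word_append_left initial_word_rauzy_subst_snoc by blast

section \<open>The spectrum as the set of end points of a tiling\<close>

definition tiling_point :: "nat \<Rightarrow> nat \<Rightarrow> real" where
  "tiling_point m n = (\<Sum>i<n. gap_length m (mbonacci_word m i))"

lemma strict_mono_tiling_point: "m \<ge> 2 \<Longrightarrow> strict_mono (tiling_point m)"
  unfolding strict_mono_Suc_iff tiling_point_def
  using gap_length_pos[OF _ mbonacci_word_letter] by simp

lemma tiling_point_length:
  assumes "initial_word m w"
  shows "tiling_point m (length w) = sum_list (map (gap_length m) w)"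
  by (simp add: tiling_point_def sum_list_sum_nth initial_word_nth[OF assms] lessThan_atLeast0)

text \<open>
  Stretching by \<open>q\<close> moves the end point with index \<open>n\<close> to an end point again; this is the new index.
\<close>

definition inflated_index :: "nat \<Rightarrow> nat \<Rightarrow> nat" where
  "inflated_index m n = length (rauzy_subst m (map (mbonacci_word m) [0..<n]))"

lemma tiling_point_inflated_index:
  assumes "m \<ge> 2"
  shows "tiling_point m (inflated_index m n) = mbonacci_root m * tiling_point m n"
    and "tiling_point m (Suc (inflated_index m n)) = mbonacci_root m * tiling_point m n + 1"
proof -
  let ?w = "map (mbonacci_word m) [0..<n]"
  have w: "initial_word m ?w"
    by simp
  note len = tiled_length_rauzy_subst[OF assms initial_word_letters[OF assms w]]
  have n: "tiling_point m n = sum_list (map (gap_length m) ?w)"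
    using tiling_point_length[OF w] by simp
  show "tiling_point m (inflated_index m n) = mbonacci_root m * tiling_point m n"
    using tiling_point_length[OF initial_word_rauzy_subst[OF assms w]] len n
    by (simp add: inflated_index_def)
  show "tiling_point m (Suc (inflated_index m n)) = mbonacci_root m * tiling_point m n + 1"
    using tiling_point_length[OF initial_word_rauzy_subst_snoc[OF assms w]] len n
    by (simp add: inflated_index_def)
qed

text \<open>
  The inflated indices begin with 0 and increase in steps of 1 or 2, as images of letters have one
  or two letters; so every index is an inflated one or succeeds one.  That the preimage \<open>k\<close> is
  smaller than \<open>n\<close> makes an induction on \<open>n\<close> possible.
\<close>

lemma index_cases_inflated:
  assumes "m \<ge> 2" and "n > 0"
  obtains k where "k < n" and "n = inflated_index m k \<or> n = Suc (inflated_index m k)"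
proof -
  have Suc: "inflated_index m (Suc k) = inflated_index m k + length (rauzy_letter m (mbonacci_word m k))"
    for k by (simp add: inflated_index_def rauzy_subst_Cons)
  have zero: "inflated_index m 0 = 0"
    by (simp add: inflated_index_def)
  have "mbonacci_word m 0 = 1"
    using mbonacci_word_nth[of m 0 0] assms(1) by (simp add: mbonacci_block_0)
  then have one: "inflated_index m 1 = 2"
    using Suc[of 0] zero assms(1) by (simp add: rauzy_letter_def)
  have grow: "k < inflated_index m k" if "k \<ge> 1" for k
    using that by (induction k rule: dec_induct) (use one in \<open>auto simp: Suc rauzy_letter_def\<close>)
  \<comment> \<open>The inflated indices are unbounded, so some step between neighbours passes \<open>n\<close>.\<close>
  have "\<exists>k. inflated_index m k \<le> n \<and> n < inflated_index m (Suc k)"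
  proof (rule ccontr)
    assume "\<not> ?thesis"
    then have "inflated_index m k \<le> n" for k
      by (induction k) (use zero in \<open>auto simp: not_less\<close>)
    from this[of n] grow[of n] assms(2) show False
      by simp
  qed
  then obtain k where k: "inflated_index m k \<le> n" "n < inflated_index m (Suc k)"
    by blast
  show thesis
  proof
    show "k < n"
      using k(1) grow[of k] assms(2) by (cases k) auto
    have "inflated_index m (Suc k) \<le> inflated_index m k + 2"
      by (simp add: Suc rauzy_letter_def)
    then show "n = inflated_index m k \<or> n = Suc (inflated_index m k)"
      using k by linarith
  qed
qed

text \<open>
  The next three lemmas characterise the spectrum as the least set that contains 0 and is closed
  under \<open>x \<mapsto> q x\<close> and \<open>x \<mapsto> q x + 1\<close>.
\<close>

lemma spectrum_zero: "0 \<in> spectrum q"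
  unfolding spectrum_def by (auto intro!: exI[of _ "\<lambda>_. 0"])

lemma spectrum_step:
  assumes "x \<in> spectrum q" and "e \<in> {0, 1}"
  shows "q * x + e \<in> spectrum q"
proof -
  obtain \<epsilon> n where x: "x = (\<Sum>i\<le>n. \<epsilon> i * q ^ i)" and \<epsilon>: "\<forall>i. \<epsilon> i \<in> {0, 1}"
    using assms(1) by (auto simp: spectrum_def)
  have "q * x + e = (\<Sum>i\<le>Suc n. case_nat e \<epsilon> i * q ^ i)"
    by (simp add: x sum.atMost_Suc_shift sum_distrib_left mult_ac del: sum.atMost_Suc)
  moreover have "\<forall>i. case_nat e \<epsilon> i \<in> {0, 1}"
    using assms(2) \<epsilon> by (auto split: nat.split)
  ultimately show ?thesis
    unfolding spectrum_def by blast
qed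

lemma spectrum_least:
  assumes zero: "0 \<in> X" and step: "\<And>x e. x \<in> X \<Longrightarrow> e \<in> {0, 1} \<Longrightarrow> q * x + e \<in> X"
  shows "spectrum q \<subseteq> X"
proof -
  have "(\<Sum>i<n. \<epsilon> i * q ^ i) \<in> X" if "\<forall>i. \<epsilon> i \<in> {0, 1}" for n \<epsilon>
    using that
  proof (induction n arbitrary: \<epsilon>)
    case 0
    then show ?case
      using zero by simp
  next
    case (Suc n)
    have "(\<Sum>i<Suc n. \<epsilon> i * q ^ i) = q * (\<Sum>i<n. \<epsilon> (Suc i) * q ^ i) + \<epsilon> 0"
      by (simp add: sum.lessThan_Suc_shift sum_distrib_left mult_ac del: sum.lessThan_Suc)
    then show ?case
      using step[OF Suc.IH[of "\<lambda>i. \<epsilon> (Suc i)"], of "\<epsilon> 0"] Suc.prems by simp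
  qed
  then show ?thesis
    by (auto simp: spectrum_def lessThan_Suc_atMost[symmetric] simp del: sum.lessThan_Suc)
qed

lemma range_tiling_point:
  assumes "m \<ge> 2"
  shows "range (tiling_point m) = spectrum (mbonacci_root m)"
proof
  have "tiling_point m n \<in> spectrum (mbonacci_root m)" for n
  proof (induction n rule: less_induct)
    case (less n)
    show ?case
    proof (cases "n = 0")
      case True
      then show ?thesis
        by (simp add: tiling_point_def spectrum_zero)
    next
      case False
      then obtain k where "k < n" and "n = inflated_index m k \<or> n = Suc (inflated_index m k)"
        using index_cases_inflated[OF assms] by blast
      then show ?thesis
        using spectrum_step[OF less.IH[of k], of 0] spectrum_step[OF less.IH[of k], of 1]
          tiling_point_inflated_index[OF assms, of k] by auto
    qed
  qed
  then show "range (tiling_point m) \<subseteq> spectrum (mbonacci_root m)"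
    by blast
  show "spectrum (mbonacci_root m) \<subseteq> range (tiling_point m)"
  proof (rule spectrum_least)
    show "0 \<in> range (tiling_point m)"
      by (rule range_eqI[of _ _ 0]) (simp add: tiling_point_def)
    show "mbonacci_root m * x + e \<in> range (tiling_point m)"
      if "x \<in> range (tiling_point m)" "e \<in> {0, 1}" for x e
      using that tiling_point_inflated_index[OF assms] by (auto simp: image_iff) metis+
  qed
qed

text \<open>This makes the definite description in \<^const>\<open>spectrum_enum\<close> well determined.\<close>

lemma strict_mono_nat_range_unique:
  fixes f g :: "nat \<Rightarrow> 'a :: linorder"
  assumes f: "strict_mono f" and g: "strict_mono g" and range: "range f = range g"
  shows "f = g"
proof
  fix n
  show "f n = g n"
  proof (induction n rule: less_induct)
    case (less n)
    have aux: "f' n \<le> g' n"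
      if f': "strict_mono f'" and g': "strict_mono g'" and range': "range f' = range g'"
        and below: "\<And>k. k < n \<Longrightarrow> f' k = g' k"
      for f' g' :: "nat \<Rightarrow> 'a"
    proof -
      obtain k where k: "g' n = f' k"
        using range' by (metis rangeE rangeI)
      then have "\<not> k < n"
        using below g' by (metis less_irrefl strict_mono_less)
      then show ?thesis
        using k f' by (simp add: strict_mono_less_eq)
    qed
    show ?case
      using aux[of f g] aux[of g f] less f g range by (simp add: order_antisym)
  qed
qed

lemma spectrum_enum_eq_tiling_point:
  assumes "m \<ge> 2"
  shows "spectrum_enum (mbonacci_root m) = tiling_point m"
  unfolding spectrum_enum_def
proof (rule the_equality)
  show "strict_mono (tiling_point m) \<and> range (tiling_point m) = spectrum (mbonacci_root m)"
    using strict_mono_tiling_point range_tiling_point assms by blast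
  then show "f = tiling_point m" if "strict_mono f \<and> range f = spectrum (mbonacci_root m)" for f
    using that strict_mono_nat_range_unique by metis
qed

lemma tiling_point_diff:
  "tiling_point m (n + N) - tiling_point m n =
    sum_list (map (gap_length m) (map (mbonacci_word m) [n..<n + N]))"
proof -
  have "tiling_point m (n + N) = tiling_point m n + (\<Sum>i = n..<n + N. gap_length m (mbonacci_word m i))"
    unfolding tiling_point_def lessThan_atLeast0
    by (rule sum.atLeastLessThan_concat[symmetric]) auto
  then show ?thesis
    by (simp add: interv_sum_list_conv_sum_set_nat comp_def)
qed

section \<open>Letter counts in the initial words\<close>

lemma count_rauzy_subst:
  assumes "m \<ge> 2" and "set w \<subseteq> {1..m}"
  shows "count_list (rauzy_subst m w) 1 = length w"
    and "j \<in> {1..<m} \<Longrightarrow> count_list (rauzy_subst m w) (Suc j) = count_list w j"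
  using assms(2) by (induction w) (auto simp: rauzy_subst_Cons rauzy_letter_def)

lemma sum_list_map_eq_sum_count_on:
  fixes f :: "'a \<Rightarrow> 'b :: comm_semiring_1"
  assumes "finite A" and "set w \<subseteq> A"
  shows "sum_list (map f w) = (\<Sum>j\<in>A. of_nat (count_list w j) * f j)"
  using assms(2)
proof (induction w)
  case (Cons k w)
  have "(\<Sum>j\<in>A. of_nat (count_list (k # w) j) * f j) =
      (\<Sum>j\<in>A. (if k = j then f j else 0) + of_nat (count_list w j) * f j)"
    by (intro sum.cong) (auto simp: algebra_simps)
  also have "\<dots> = f k + (\<Sum>j\<in>A. of_nat (count_list w j) * f j)"
    using Cons.prems assms(1) by (simp add: sum.distrib)
  finally show ?case
    using Cons by simp
qed simp

lemma mbonacci_nat_small: "h < m \<Longrightarrow> mbonacci_nat m h = 2 ^ h"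
  by (simp add: mbonacci_nat.simps[of m h])

text \<open>
  With the values at negative indices, the recurrence holds from \<open>h = 0\<close> on: for \<open>h < m\<close> the term
  with \<open>j = h + 1\<close> contributes \<open>F\<^sub>-\<^sub>1 = 1\<close>, which completes \<open>2\<^sup>0 + \<dots> + 2\<^sup>h\<^sup>-\<^sup>1\<close> to \<open>2\<^sup>h\<close>.
\<close>

lemma mbonacci_recurrence:
  assumes "m \<ge> 2"
  shows "mbonacci m (int h) = (\<Sum>j = 1..m. mbonacci m (int h - int j))"
proof (cases "h < m")
  case False
  then show ?thesis
    by (simp add: mbonacci_def mbonacci_nat.simps[of m h] nat_diff_distrib flip: of_nat_diff)
next
  case True
  have split: "{1..m} = {1..h} \<union> {Suc h} \<union> {Suc (Suc h)..m}"
    using True by auto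
  have "(\<Sum>j = 1..m. mbonacci m (int h - int j)) = (\<Sum>j = 1..h. mbonacci m (int h - int j)) + 1"
    unfolding split by (subst sum.union_disjoint; simp add: mbonacci_def)+
  also have "(\<Sum>j = 1..h. mbonacci m (int h - int j)) = (\<Sum>j = 1..h. 2 ^ (h - j))"
    using True by (intro sum.cong) (auto simp: mbonacci_def mbonacci_nat_small nat_diff_distrib)
  also have "\<dots> = (\<Sum>i<h. 2 ^ i)"
    by (rule sum.reindex_bij_witness[of _ "\<lambda>i. h - i" "\<lambda>j. h - j"]) auto
  also have "\<dots> = 2 ^ h - (1::int)"
    by (induction h) auto
  finally show ?thesis
    using True by (simp add: mbonacci_def mbonacci_nat_small)
qed

text \<open>
  Substituting turns each letter \<open>j < m\<close> into \<open>j + 1\<close>, drops each \<open>m\<close>, and creates one letter 1 for each letter of the word.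
  Hence counts shift by one index from \<open>h\<close> to \<open>h + 1\<close>, the count of 1 is the previous length, and
  the lengths satisfy the \<open>m\<close>-bonacci recurrence.
\<close>

lemma count_and_length_mbonacci_block:
  assumes "m \<ge> 2"
  shows "\<forall>j\<in>{1..m}. int (count_list (mbonacci_block m h) j) = mbonacci m (int h - int j)"
    and "int (length (mbonacci_block m h)) = mbonacci m (int h)"
proof (induction h)
  case 0
  {
    case 1
    show ?case
      by (auto simp: mbonacci_block_0 mbonacci_def)
  next
    case 2
    show ?case
      using assms by (simp add: mbonacci_block_0 mbonacci_def mbonacci_nat_small)
  }
next
  case (Suc h)
  note letters = mbonacci_block_letters[OF assms]
  note count = count_rauzy_subst[OF assms letters[of h], folded mbonacci_block_Suc]
  {
    case 1
    show ?case
    proof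
      fix j assume j: "j \<in> {1..m}"
      then obtain i where i: "j = Suc i"
        by (cases j) auto
      show "int (count_list (mbonacci_block m (Suc h)) j) = mbonacci m (int (Suc h) - int j)"
        using j count(1) count(2)[of i] Suc.IH by (cases "i = 0") (auto simp: i)
    qed
  }
  note counts = this
  case 2
  have "int (length (mbonacci_block m (Suc h))) =
      (\<Sum>j = 1..m. int (count_list (mbonacci_block m (Suc h)) j))"
    using sum_count_set[OF letters[of "Suc h"]] by (simp flip: of_nat_sum)
  also have "\<dots> = (\<Sum>j = 1..m. mbonacci m (int (Suc h) - int j))"
    using counts by (intro sum.cong) auto
  also have "\<dots> = mbonacci m (int (Suc h))"
    by (rule mbonacci_recurrence[OF assms, symmetric])
  finally show ?case .
qed

text \<open>
  Blocks are taken from the highest digit down: with this order the word obeys Horner's scheme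
  \<open>digit_word_Suc\<close>, with the substitution in the role of the multiplication by the base.
\<close>

definition digit_word :: "nat \<Rightarrow> (nat \<Rightarrow> nat) \<Rightarrow> nat \<Rightarrow> nat list" where
  "digit_word m x K = concat (map (\<lambda>h. if x h = 0 then [] else mbonacci_block m h) (rev [0..<K]))"

lemma digit_word_Suc:
  "digit_word m x (Suc K) =
    rauzy_subst m (digit_word m (\<lambda>h. x (Suc h)) K) @ (if x 0 = 0 then [] else [1])"
proof (induction K)
  case 0
  show ?case
    by (simp add: digit_word_def mbonacci_block_0)
next
  case (Suc K)
  have step: "digit_word m y (Suc k) = (if y k = 0 then [] else mbonacci_block m k) @ digit_word m y k"
    for y k by (simp add: digit_word_def)
  show ?case
    by (simp add: step[of x "Suc K"] step[of "\<lambda>h. x (Suc h)" K] Suc mbonacci_block_Suc)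
qed

text \<open>
  Each step of Horner's scheme is a substitution, perhaps followed by the letter 1, and both operations
  preserve initial words.
\<close>

lemma initial_word_digit_word:
  assumes "m \<ge> 2"
  shows "initial_word m (digit_word m x K)"
proof (induction K arbitrary: x)
  case 0
  show ?case
    by (simp add: digit_word_def initial_word_def)
next
  case (Suc K)
  show ?case
    using initial_word_rauzy_subst[OF assms Suc] initial_word_rauzy_subst_snoc[OF assms Suc]
    by (simp add: digit_word_Suc)
qed

lemma count_and_length_digit_word:
  assumes "m \<ge> 2" and "\<forall>h. x h \<in> {0, 1}"
  shows "j \<in> {1..m} \<Longrightarrow> int (count_list (digit_word m x K) j) =
      (\<Sum>h<K. int (x h) * mbonacci m (int h - int j))"
    and "int (length (digit_word m x K)) = (\<Sum>h<K. int (x h) * mbonacci m (int h))"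
proof -
  have digit: "x h = 0 \<or> x h = 1" for h
    using assms(2) by auto
  have step: "digit_word m x (Suc k) = (if x k = 0 then [] else mbonacci_block m k) @ digit_word m x k"
    for k by (simp add: digit_word_def)
  have zero: "digit_word m x 0 = []"
    by (simp add: digit_word_def)
  show "int (count_list (digit_word m x K) j) =
      (\<Sum>h<K. int (x h) * mbonacci m (int h - int j))" if "j \<in> {1..m}"
  proof (induction K)
    case (Suc K)
    then show ?case
      using count_and_length_mbonacci_block(1)[OF assms(1), of K] that digit[of K]
      by (auto simp: step)
  qed (simp add: zero)
  show "int (length (digit_word m x K)) = (\<Sum>h<K. int (x h) * mbonacci m (int h))"
  proof (induction K)
    case (Suc K)
    then show ?case
      using count_and_length_mbonacci_block(2)[OF assms(1), of K] digit[of K]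
      by (auto simp: step)
  qed (simp add: zero)
qed

text \<open>
  For digits that expand \<open>N\<close>, the digit word is an initial word of length \<open>N\<close>, and there is only one.
\<close>

lemma count_initial_word_expansion:
  assumes "m \<ge> 2" and x: "canonical_expansion m N x" and j: "j \<in> {1..m}"
  shows "int (count_list (map (mbonacci_word m) [0..<N]) j) =
    (\<Sum>h | x h \<noteq> 0. int (x h) * mbonacci m (int h - int j))"
proof -
  have "finite {h. x h \<noteq> 0}" and digits: "\<forall>h. x h \<in> {0, 1}"
    and N: "int N = (\<Sum>h | x h \<noteq> 0. int (x h) * mbonacci m (int h))"
    using x by (auto simp: canonical_expansion_def)
  then obtain K where K: "\<forall>h\<in>{h. x h \<noteq> 0}. h < K"
    using finite_nat_set_iff_bounded by blast
  have supp: "(\<Sum>h<K. int (x h) * f h) = (\<Sum>h | x h \<noteq> 0. int (x h) * f h)" for f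
    using K by (intro sum.mono_neutral_right) auto
  have "int (length (digit_word m x K)) = int N"
    using count_and_length_digit_word(2)[OF assms(1) digits] N supp by simp
  then have "digit_word m x K = map (mbonacci_word m) [0..<N]"
    using initial_word_digit_word[OF assms(1), of x K] unfolding initial_word_def by simp
  then show ?thesis
    using count_and_length_digit_word(1)[OF assms(1) digits j, of K] supp by simp
qed

section \<open>Gaps in the spectrum\<close>

theorem theorem1p1:
  fixes m N :: nat
  assumes "m \<ge> 2" and "N \<ge> 1"
  shows "(\<exists>\<gamma>>0. \<forall>n\<ge>1.
            spectrum_enum (mbonacci_root m) (n + N) - spectrum_enum (mbonacci_root m) n
              \<ge> real N * \<gamma>) \<and>
         (\<forall>x b \<gamma>.
            canonical_expansion m N x \<and> b \<ge> 1 \<and> balanced m b (mbonacci_word m) \<and>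
            \<gamma> = 1 / real N *
                  (\<Sum>j = 1..m.
                     real_of_int ((\<Sum>h | x h \<noteq> 0. int (x h) * mbonacci m (int h - int j)) - int b)
                       * gap_length m j) \<longrightarrow>
            (\<forall>n\<ge>1.
               spectrum_enum (mbonacci_root m) (n + N) - spectrum_enum (mbonacci_root m) n
                 \<ge> real N * \<gamma>))"
proof (intro conjI allI impI)
  let ?\<gamma> = "Min (gap_length m ` {1..m})"
  have "?\<gamma> > 0"
    using gap_length_pos[OF assms(1)] assms(1) by (subst Min_gr_iff) auto
  moreover have "tiling_point m (n + N) - tiling_point m n \<ge> real N * ?\<gamma>" for n
  proof -
    have "real N * ?\<gamma> = (\<Sum>i = n..<n + N. ?\<gamma>)"
      by simp
    also have "\<dots> \<le> (\<Sum>i = n..<n + N. gap_length m (mbonacci_word m i))"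
      using mbonacci_word_letter[OF assms(1)] by (intro sum_mono Min_le) auto
    also have "\<dots> = tiling_point m (n + N) - tiling_point m n"
      by (simp add: tiling_point_diff interv_sum_list_conv_sum_set_nat comp_def)
    finally show ?thesis .
  qed
  ultimately show "\<exists>\<gamma>>0. \<forall>n\<ge>1.
      spectrum_enum (mbonacci_root m) (n + N) - spectrum_enum (mbonacci_root m) n \<ge> real N * \<gamma>"
    using spectrum_enum_eq_tiling_point[OF assms(1)] by auto
next
  fix x b \<gamma> n
  assume "canonical_expansion m N x \<and> b \<ge> 1 \<and> balanced m b (mbonacci_word m) \<and>
    \<gamma> = 1 / real N * (\<Sum>j = 1..m.
      real_of_int ((\<Sum>h | x h \<noteq> 0. int (x h) * mbonacci m (int h - int j)) - int b)
        * gap_length m j)"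
  then have x: "canonical_expansion m N x" and bal: "balanced m b (mbonacci_word m)"
    and \<gamma>: "\<gamma> = 1 / real N * (\<Sum>j = 1..m.
      real_of_int ((\<Sum>h | x h \<noteq> 0. int (x h) * mbonacci m (int h - int j)) - int b)
        * gap_length m j)"
    by auto
  let ?p = "map (mbonacci_word m) [0..<N]" and ?w = "map (mbonacci_word m) [n..<n + N]"
  have "subword ?p (mbonacci_word m)" "subword ?w (mbonacci_word m)"
    unfolding subword_def by (auto intro: exI[of _ 0] exI[of _ n])
  then have "\<bar>int (count_list ?p j) - int (count_list ?w j)\<bar> \<le> int b" if "j \<in> {1..m}" for j
    using bal that unfolding balanced_def by simp
  then have count: "int (count_list ?p j) - int b \<le> int (count_list ?w j)" if "j \<in> {1..m}" for j
    using that by fastforce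
  have "real N * \<gamma> = (\<Sum>j = 1..m. real_of_int (int (count_list ?p j) - int b) * gap_length m j)"
    using assms(2) count_initial_word_expansion[OF assms(1) x] by (simp add: \<gamma>)
  also have "\<dots> \<le> (\<Sum>j = 1..m. real (count_list ?w j) * gap_length m j)"
  proof (intro sum_mono mult_right_mono)
    fix j assume j: "j \<in> {1..m}"
    show "real_of_int (int (count_list ?p j) - int b) \<le> real (count_list ?w j)"
      using count[OF j] by linarith
    show "0 \<le> gap_length m j"
      using gap_length_pos[OF assms(1) j] by simp
  qed
  also have "\<dots> = sum_list (map (gap_length m) ?w)"
    using mbonacci_word_letter[OF assms(1)] by (intro sum_list_map_eq_sum_count_on[symmetric]) auto
  finally show "spectrum_enum (mbonacci_root m) (n + N) - spectrum_enum (mbonacci_root m) n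
      \<ge> real N * \<gamma>"
    using spectrum_enum_eq_tiling_point[OF assms(1)] tiling_point_diff[of m n N] by simp
qed

end
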